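(* Let $K>0$ and $\gamma\ge 1$ be constants, and consider the compressible Euler equations in $\mathbb{R}^3$ for the density $\rho(t,x,y,z)\ge 0$ and the velocity $\vec u(t,x,y,z)=(u_1,u_2,u_3)$: $$\rho_t+\nabla\cdot(\rho\vec u)=0,\qquad \rho\left[\vec u_t+(\vec u\cdot\nabla)\vec u\right]+K\nabla\rho^{\gamma}=0 .$$ Let $\xi\neq 0$, $\lambda\in\mathbb{R}$, $\alpha\ge 0$, $a_0>0$, $a_1\in\mathbb{R}$, $b_0>0$, $b_1\in\mathbb{R}$ be arbitrary constants. Let $a(t)>0$, $b(t)>0$ be the (locally existing) solution of the Emden system $$\ddot a(t)-\frac{\xi^2}{a^3(t)}=\frac{\lambda}{a^{2\gamma-1}(t)\,b^{\gamma-1}(t)},\quad a(0)=a_0,\ \dot a(0)=a_1,$$ $$\ddot b(t)=\frac{\lambda}{a^{2\gamma-2}(t)\,b^{\gamma}(t)},\quad b(0)=b_0,\ \dot b(0)=b_1,$$ on an interval $[0,T)$ on which it exists. Put $s=\dfrac{x^2+y^2}{a^2(t)}+\dfrac{z^2}{b^2(t)}$ and $$f(s)=\begin{cases}\alpha e^{-\frac{\lambda}{2K}s}, & \gamma=1,\\[4pt] \max\left(\left(-\frac{\lambda(\gamma-1)}{2K\gamma}s+\alpha\right)^{\frac1{\gamma-1}},\,0\right), & \gamma>1.\end{cases}$$ Then $$\rho=\frac{f(s)}{a^2(t)b(t)},\qquad u_1=\frac{\dot a(t)}{a(t)}x-\frac{\xi}{a^2(t)}y,\qquad u_2=\frac{\xi}{a^2(t)}x+\frac{\dot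 a(t)}{a(t)}y,\qquad u_3=\frac{\dot b(t)}{b(t)}z$$ is a solution of the compressible Euler equations in $\mathbb{R}^3$ for $t\in[0,T)$. In particular, if any one of the following conditions holds, the solution $(\rho,\vec u)$ is $C^1$: (1) $\gamma=1$; (2a) $\gamma>1$ and $\lambda\le 0$; (2b) $\gamma>1$, $\lambda>0$ and $\gamma<2$.
   Context: Dots denote derivatives with respect to $t$. For $\gamma>1$, the expression $\max((\cdot)^{1/(\gamma-1)},0)$ is a cut-off: it equals $0$ wherever the base $-\frac{\lambda(\gamma-1)}{2K\gamma}s+\alpha$ is negative. In general "solution" is understood in the weak sense that $\rho,\vec u$ are continuous and the equations hold outside a set of points $(t,x,y,z)$ of Lebesgue measure zero (where $\rho$ may fail to be differentiable). "$C^1$" refers to $\rho$ and $\vec u$ as functions of $(t,x,y,z)\in[0,T)\times\mathbb{R}^3$.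
   Formalization: In case (2a) the density is not claimed to be C^1 when α=0, λ<0 and γ≥3: there ρ(t,x,0,0)=C(t)|x|^{2/(γ-1)} with exponent ≤1, which is not differentiable at x=0. The velocity is still C^1 and (ρ,u) is still a solution. *)

theory Defs
  imports "HOL-Analysis.Analysis"
begin

(* T is extended real, so that global solutions (T = \<infinity>) are included. *)
definition time_interval :: "ereal \<Rightarrow> real set" where
  "time_interval T = {t. 0 \<le> t \<and> ereal t < T}"

definition slab :: "ereal \<Rightarrow> (real \<times> (real^3)) set" where
  "slab T = time_interval T \<times> UNIV"

(* The derivatives in time are relative to [0, T), hence one-sided at t = 0. *)
definition d_time :: "ereal \<Rightarrow> (real \<times> (real^3) \<Rightarrow> 'a::real_normed_vector) \<Rightarrow> real \<times> (real^3) \<Rightarrow> 'a" where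
  "d_time T g p = vector_derivative (\<lambda>t. g (t, snd p)) (at (fst p) within time_interval T)"

definition d_space :: "3 \<Rightarrow> (real \<times> (real^3) \<Rightarrow> 'a::real_normed_vector) \<Rightarrow> real \<times> (real^3) \<Rightarrow> 'a" where
  "d_space i g p = vector_derivative (\<lambda>h. g (fst p, snd p + h *\<^sub>R axis i 1)) (at 0)"

definition grad :: "(real \<times> (real^3) \<Rightarrow> real) \<Rightarrow> real \<times> (real^3) \<Rightarrow> real^3" where
  "grad g p = (\<chi> i. d_space i g p)"

definition divergence :: "(real \<times> (real^3) \<Rightarrow> real^3) \<Rightarrow> real \<times> (real^3) \<Rightarrow> real" where
  "divergence v p = (\<Sum>i\<in>UNIV. d_space i (\<lambda>q. v q $ i) p)"

definition advect :: "(real \<times> (real^3) \<Rightarrow> real^3) \<Rightarrow> (real \<times> (real^3) \<Rightarrow> real^3) \<Rightarrow> real \<times> (real^3) \<Rightarrow> real^3" where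
  "advect v w p = (\<Sum>j\<in>UNIV. (v p $ j) *\<^sub>R d_space j w p)"

(* vector_derivative is total, so differentiability has to be demanded separately. *)
definition euler_equations_at ::
  "real \<Rightarrow> real \<Rightarrow> ereal \<Rightarrow> (real \<times> (real^3) \<Rightarrow> real) \<Rightarrow> (real \<times> (real^3) \<Rightarrow> real^3) \<Rightarrow> real \<times> (real^3) \<Rightarrow> bool" where
  "euler_equations_at K \<gamma> T \<rho> u p \<longleftrightarrow>
     \<rho> differentiable (at p within slab T) \<and>
     u differentiable (at p within slab T) \<and>
     (\<lambda>q. \<rho> q powr \<gamma>) differentiable (at p within slab T) \<and>
     d_time T \<rho> p + divergence (\<lambda>q. \<rho> q *\<^sub>R u q) p = 0 \<and>
     \<rho> p *\<^sub>R (d_time T u p + advect u u p) + K *\<^sub>R grad (\<lambda>q. \<rho> q powr \<gamma>) p = 0"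

definition euler_solution ::
  "real \<Rightarrow> real \<Rightarrow> ereal \<Rightarrow> (real \<times> (real^3) \<Rightarrow> real) \<Rightarrow> (real \<times> (real^3) \<Rightarrow> real^3) \<Rightarrow> bool" where
  "euler_solution K \<gamma> T \<rho> u \<longleftrightarrow>
     (\<forall>p\<in>slab T. 0 \<le> \<rho> p) \<and>
     continuous_on (slab T) \<rho> \<and> continuous_on (slab T) u \<and>
     (\<exists>N. negligible N \<and> (\<forall>p\<in>slab T - N. euler_equations_at K \<gamma> T \<rho> u p))"

definition C1_on :: "('a::real_normed_vector) set \<Rightarrow> ('a \<Rightarrow> 'b::real_normed_vector) \<Rightarrow> bool" where
  "C1_on S g \<longleftrightarrow>
     (\<exists>g'. (\<forall>p\<in>S. (g has_derivative blinfun_apply (g' p)) (at p within S)) \<and> continuous_on S g')"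

(* a' and b' are the first derivatives of a and b. *)
definition emden_solution ::
  "real \<Rightarrow> real \<Rightarrow> real \<Rightarrow> real \<Rightarrow> real \<Rightarrow> real \<Rightarrow> real \<Rightarrow> ereal \<Rightarrow>
   (real \<Rightarrow> real) \<Rightarrow> (real \<Rightarrow> real) \<Rightarrow> (real \<Rightarrow> real) \<Rightarrow> (real \<Rightarrow> real) \<Rightarrow> bool" where
  "emden_solution \<gamma> \<xi> lam a0 a1 b0 b1 T a a' b b' \<longleftrightarrow>
     a 0 = a0 \<and> a' 0 = a1 \<and> b 0 = b0 \<and> b' 0 = b1 \<and>
     (\<forall>t\<in>time_interval T.
        0 < a t \<and> 0 < b t \<and>
        (a has_real_derivative a' t) (at t within time_interval T) \<and>
        (b has_real_derivative b' t) (at t within time_interval T) \<and>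
        (a' has_real_derivative
           (\<xi>^2 / a t ^ 3 + lam / (a t powr (2 * \<gamma> - 1) * b t powr (\<gamma> - 1))))
           (at t within time_interval T) \<and>
        (b' has_real_derivative lam / (a t powr (2 * \<gamma> - 2) * b t powr \<gamma>))
           (at t within time_interval T))"

(* In the case \<gamma> > 1 the cut-off is applied to the base, because powr is not
   meaningful for negative bases; note 0 powr r = 0. *)
definition profile :: "real \<Rightarrow> real \<Rightarrow> real \<Rightarrow> real \<Rightarrow> real \<Rightarrow> real" where
  "profile K \<gamma> lam \<alpha> s =
     (if \<gamma> = 1 then \<alpha> * exp (- (lam / (2 * K)) * s)
      else (max (- (lam * (\<gamma> - 1) / (2 * K * \<gamma>)) * s + \<alpha>) 0) powr (1 / (\<gamma> - 1)))"

definition similarity_var :: "(real \<Rightarrow> real) \<Rightarrow> (real \<Rightarrow> real) \<Rightarrow> real \<times> (real^3) \<Rightarrow> real" where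
  "similarity_var a b = (\<lambda>(t, x). ((x$1)^2 + (x$2)^2) / (a t)^2 + (x$3)^2 / (b t)^2)"

definition gas_density ::
  "real \<Rightarrow> real \<Rightarrow> real \<Rightarrow> real \<Rightarrow> (real \<Rightarrow> real) \<Rightarrow> (real \<Rightarrow> real) \<Rightarrow> real \<times> (real^3) \<Rightarrow> real" where
  "gas_density K \<gamma> lam \<alpha> a b =
     (\<lambda>(t, x). profile K \<gamma> lam \<alpha> (similarity_var a b (t, x)) / ((a t)^2 * b t))"

definition velocity ::
  "real \<Rightarrow> (real \<Rightarrow> real) \<Rightarrow> (real \<Rightarrow> real) \<Rightarrow> (real \<Rightarrow> real) \<Rightarrow> (real \<Rightarrow> real) \<Rightarrow> real \<times> (real^3) \<Rightarrow> real^3" where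
  "velocity \<xi> a a' b b' =
     (\<lambda>(t, x). vector [a' t / a t * x$1 - \<xi> / (a t)^2 * x$2,
                       \<xi> / (a t)^2 * x$1 + a' t / a t * x$2,
                       b' t / b t * x$3])"

end

theory Submission
  imports Defs
begin

text \<open>
  Since the flow transports the similarity variable \<open>s\<close> and has divergence \<open>(a\<^sup>2 b)' / (a\<^sup>2 b)\<close>,
  the mass equation holds for every profile \<open>f\<close>. The swirl terms in the acceleration cancel
  against \<open>\<xi>\<^sup>2 / a\<^sup>3\<close>, and the Emden system reduces the momentum equation to the single ordinary
  differential equation \<open>K (f\<^sup>\<gamma>)' = - (\<lambda>/2) f\<close>. The profile satisfies it wherever the base of
  the power is nonzero; the exceptional set is a family of ellipsoids parametrised by time, hence
  negligible. For the \<open>C\<^sup>1\<close> claim, \<open>s = |w|\<^sup>2\<close> for the rescaled position \<open>w\<close>, and \<open>\<rho>\<close> is \<open>f(|w|\<^sup>2)\<close>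
  times a \<open>C\<^sup>1\<close> factor. Only \<open>\<alpha> = 0\<close>, \<open>\<lambda> < 0\<close> needs care: there \<open>f(|w|\<^sup>2)\<close> is a multiple of \<open>|w|\<close> to the
  power \<open>2 / (\<gamma> - 1)\<close>, which exceeds 1 exactly when \<open>\<gamma> < 3\<close>.
\<close>

section \<open>Partial derivatives on the slab\<close>

text \<open>In a connected set with two points, every point is a limit point. This makes derivatives
  relative to \<open>[0, T)\<close> unique, also at \<open>t = 0\<close>.\<close>

lemma time_interval_nontrivial:
  assumes "T > 0" "t \<in> time_interval T"
  shows "at t within time_interval T \<noteq> bot"
proof -
  obtain r where r: "0 < r" "ereal r < T"
    using ereal_dense2[OF \<open>T > 0\<close>] by auto
  have "0 \<in> time_interval T" "r \<in> time_interval T"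
    using r assms(1) by (auto simp: time_interval_def simp flip: zero_ereal_def)
  moreover have "connected (time_interval T)"
    unfolding connected_iff_interval time_interval_def
    by (auto intro: order.strict_trans1 ereal_less_eq(3)[THEN iffD2])
  ultimately have "t islimpt time_interval T"
    using connected_imp_perfect assms(2) r(1) by (metis less_irrefl singletonD)
  then show ?thesis
    by (simp add: trivial_limit_within)
qed

text \<open>Partial derivatives are defined through the choice operator
  \<open>vector_derivative\<close>. This lemma and the next read them off one Frechet derivative by
  restricting it to coordinate lines.\<close>

lemma d_time_has_derivative:
  assumes "T > 0" "p \<in> slab T" and D: "(g has_derivative D) (at p within slab T)"
  shows "d_time T g p = D (1, 0)"
proof -
  obtain t x where p: "p = (t, x)" by force
  have t: "t \<in> time_interval T"
    using assms(2) by (simp add: p slab_def)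
  have "((\<lambda>s. g (s, x)) has_derivative (\<lambda>h. D (h, 0))) (at t within time_interval T)"
  proof (rule has_derivative_in_compose[where g = g])
    show "((\<lambda>s. (s, x)) has_derivative (\<lambda>h. (h, 0))) (at t within time_interval T)"
      by (auto intro!: derivative_eq_intros)
    show "(g has_derivative D) (at (t, x) within (\<lambda>s. (s, x)) ` time_interval T)"
      by (rule has_derivative_subset[OF D[unfolded p]]) (auto simp: slab_def)
  qed
  moreover have "(\<lambda>h. D (h, 0)) = (\<lambda>h. h *\<^sub>R D (1, 0))"
    proof
    show "D (h, 0) = h *\<^sub>R D (1, 0)" for h
      using linear_scale[OF has_derivative_linear[OF D], of h "(1, 0)"] by simp
  qed
  ultimately have "((\<lambda>s. g (s, x)) has_vector_derivative D (1, 0)) (at t within time_interval T)"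
    unfolding has_vector_derivative_def by (rule has_derivative_eq_rhs)
  then show ?thesis
    using vector_derivative_within[OF time_interval_nontrivial[OF \<open>T > 0\<close> t]]
    by (simp add: d_time_def p)
qed

text \<open>The slab contains whole spatial lines, so a derivative within the slab yields two-sided
  spatial derivatives even at \<open>t = 0\<close>.\<close>

lemma d_space_has_derivative:
  assumes "p \<in> slab T" and D: "(g has_derivative D) (at p within slab T)"
  shows "d_space i g p = D (0, axis i 1)"
proof -
  obtain t x where p: "p = (t, x)" by force
  have t: "t \<in> time_interval T"
    using assms(1) by (simp add: p slab_def)
  have "((\<lambda>h. g (t, x + h *\<^sub>R axis i 1)) has_derivative (\<lambda>h. D (0, h *\<^sub>R axis i 1))) (at 0 within UNIV)"
  proof (rule has_derivative_in_compose[where g = g])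
    show "((\<lambda>h. (t, x + h *\<^sub>R axis i 1)) has_derivative (\<lambda>h. (0, h *\<^sub>R axis i 1))) (at 0 within UNIV)"
      by (auto intro!: derivative_eq_intros)
    show "(g has_derivative D) (at (t, x + 0 *\<^sub>R axis i 1) within range (\<lambda>h. (t, x + h *\<^sub>R axis i 1)))"
      using t by (auto intro!: has_derivative_subset[OF D[unfolded p]] simp: slab_def)
  qed
  moreover have "(\<lambda>h. D (0, h *\<^sub>R axis i 1)) = (\<lambda>h. h *\<^sub>R D (0, axis i 1))"
    proof
    show "D (0, h *\<^sub>R axis i 1) = h *\<^sub>R D (0, axis i 1)" for h
      using linear_scale[OF has_derivative_linear[OF D], of h "(0, axis i 1)"] by simp
  qed
  ultimately have "((\<lambda>h. g (t, x + h *\<^sub>R axis i 1)) has_vector_derivative D (0, axis i 1)) (at 0)"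
    unfolding has_vector_derivative_def by (rule has_derivative_eq_rhs)
  then show ?thesis
    by (simp add: d_space_def p vector_derivative_at)
qed

lemma has_derivative_time:
  assumes "p \<in> slab T" "(f has_real_derivative f') (at (fst p) within time_interval T)"
  shows "((\<lambda>q. f (fst q)) has_derivative (\<lambda>h. f' * fst h)) (at p within slab T)"
proof (rule has_derivative_in_compose[where g = f and g' = "(*) f'" and f' = fst])
  show "(fst has_derivative fst) (at p within slab T)"
    by (auto intro!: derivative_eq_intros)
  have "fst ` slab T \<subseteq> time_interval T"
    by (auto simp: slab_def)
  then show "(f has_derivative (*) f') (at (fst p) within fst ` slab T)"
    using assms(2) has_derivative_subset unfolding has_field_derivative_def by blast
qed

lemma has_derivative_nth_snd [derivative_intros]:
  "((\<lambda>q. snd q $ i) has_derivative (\<lambda>h. snd h $ i)) F"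
  by (rule bounded_linear_imp_has_derivative)
    (rule bounded_linear_compose[OF bounded_linear_vec_nth bounded_linear_snd])

text \<open>The sum form reduces differentiation of a \<open>vector\<close> to the rules for sums
  and scalar multiples.\<close>

lemma vector_3_eq_sum: "(vector [x, y, z] :: real^3) = x *\<^sub>R axis 1 1 + y *\<^sub>R axis 2 1 + z *\<^sub>R axis 3 1"
  by (simp add: vec_eq_iff forall_3 axis_def)

section \<open>Differentiability of powers at the origin\<close>

text \<open>Only \<open>y = 0\<close> is delicate: there the difference quotient is at most
  \<open>\<bar>h\<bar> powr (k - 1)\<close>, which tends to 0 as \<open>k > 1\<close>. For
  \<open>y \<le> 0\<close> the formula gives 0 because \<open>0 powr r = 0\<close>.\<close>

lemma has_derivative_max_powr:
  fixes k y :: real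
  assumes "k > 0" and "y \<noteq> 0 \<or> k > 1"
  shows "((\<lambda>y. max y 0 powr k) has_real_derivative k * max y 0 powr (k - 1)) (at y)"
proof -
  consider "y > 0" | "y < 0" | "y = 0" "k > 1" using assms by linarith
  then show ?thesis
  proof cases
    case 1
    have "((\<lambda>y. y powr k) has_real_derivative k * max y 0 powr (k - 1)) (at y)"
      using 1 by (auto intro!: derivative_eq_intros)
    then show ?thesis
      by (rule has_field_derivative_transform_within_open[where S = "{0<..}"]) (use 1 in auto)
  next
    case 2
    have "((\<lambda>y. 0) has_real_derivative k * max y 0 powr (k - 1)) (at y)"
      using 2 by (auto intro!: derivative_eq_intros)
    then show ?thesis
      by (rule has_field_derivative_transform_within_open[where S = "{..<0}"]) (use 2 assms in auto)
  next
    case 3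
    have "((\<lambda>h. max h 0 powr k / h) \<longlongrightarrow> 0) (at 0)"
    proof (rule Lim_null_comparison)
      show "\<forall>\<^sub>F h in at 0. norm (max h 0 powr k / h) \<le> \<bar>h\<bar> powr (k - 1)"
        by (rule always_eventually) (auto simp: max_def powr_diff divide_nonneg_nonpos)
      show "((\<lambda>h::real. \<bar>h\<bar> powr (k - 1)) \<longlongrightarrow> 0) (at 0)"
        using 3 by (intro tendsto_zero_powrI[where b = "k - 1"] tendsto_eq_intros) auto
    qed
    then show ?thesis using 3 by (simp add: DERIV_def)
  qed
qed

text \<open>The function is the norm to the power \<open>2 * k\<close>. Away from the origin the
  chain rule applies; at the origin \<open>2 * k > 1\<close> makes it o(\<open>norm h\<close>), so
  the derivative is 0, in agreement with the formula.\<close>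

lemma has_derivative_inner_powr:
  fixes w :: "'a::real_inner" and k :: real
  assumes "k > 1 / 2"
  shows "((\<lambda>w. (w \<bullet> w) powr k) has_derivative
    (\<lambda>h. 2 * k * (w \<bullet> w) powr (k - 1) * (w \<bullet> h))) (at w)"
proof (cases "w = 0")
  case False
  then have "w \<bullet> w > 0" by simp
  have "((\<lambda>w. w \<bullet> w) has_derivative (\<lambda>h. 2 * (w \<bullet> h))) (at w)"
    by (auto intro!: derivative_eq_intros simp: inner_commute)
  from has_derivative_compose[OF this has_real_derivative_powr[OF \<open>w \<bullet> w > 0\<close>, of k, unfolded has_field_derivative_def]]
  show ?thesis
    by (rule has_derivative_eq_rhs) (simp add: mult_ac)
next
  case True
  have "((\<lambda>h. norm ((h \<bullet> h) powr k) / norm h) \<longlongrightarrow> 0) (at (0::'a))"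
  proof (rule Lim_null_comparison)
    show "\<forall>\<^sub>F h in at 0. norm (norm ((h \<bullet> h) powr k) / norm h) \<le> norm (h::'a) powr (2 * k - 1)"
    proof (rule always_eventually, rule allI)
      fix h :: 'a
      have "(h \<bullet> h) powr k = norm h powr (2 * k)"
        by (cases "h = 0") (simp_all add: dot_square_norm powr_powr flip: powr_numeral)
      then show "norm (norm ((h \<bullet> h) powr k) / norm h) \<le> norm h powr (2 * k - 1)"
        by (simp add: powr_diff)
    qed
    show "((\<lambda>h::'a. norm h powr (2 * k - 1)) \<longlongrightarrow> 0) (at 0)"
      using assms by (intro tendsto_zero_powrI[where b = "2 * k - 1"] tendsto_eq_intros) auto
  qed
  then show ?thesis
    using True assms by (simp add: has_derivative_at)
qed

text \<open>Up to the factor \<open>2 * k\<close> this is the gradient of the preceding power.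
  Scalar and vector are kept together: for \<open>k < 1\<close> the scalar blows up at the origin,
  while the norm of the product is \<open>norm w powr (2 * k - 1)\<close> and tends to 0.\<close>

lemma continuous_on_inner_powr_scaleR:
  fixes k :: real
  assumes "k > 1 / 2"
  shows "continuous_on UNIV (\<lambda>w::'a::real_inner. (w \<bullet> w) powr (k - 1) *\<^sub>R w)"
proof -
  have "isCont (\<lambda>w::'a. (w \<bullet> w) powr (k - 1) *\<^sub>R w) w" for w
  proof (cases "w = 0")
    case False
    then show ?thesis by (intro continuous_intros) auto
  next
    case True
    have "((\<lambda>w::'a. (w \<bullet> w) powr (k - 1) *\<^sub>R w) \<longlongrightarrow> 0) (at 0)"
    proof (rule Lim_null_comparison)
      show "\<forall>\<^sub>F w in at 0. norm ((w \<bullet> w) powr (k - 1) *\<^sub>R (w::'a)) \<le> norm w powr (2 * k - 1)"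
      proof (rule always_eventually, rule allI)
        fix w :: 'a
        have "norm w powr (2 * k - 1) = norm w powr (2 * (k - 1)) * norm w" if "w \<noteq> 0"
          using powr_add[of "norm w" "2 * (k - 1)" 1] that by (simp add: algebra_simps)
        then show "norm ((w \<bullet> w) powr (k - 1) *\<^sub>R w) \<le> norm w powr (2 * k - 1)"
          by (cases "w = 0") (simp_all add: dot_square_norm powr_powr flip: powr_numeral)
      qed
      show "((\<lambda>w::'a. norm w powr (2 * k - 1)) \<longlongrightarrow> 0) (at 0)"
        using assms by (intro tendsto_zero_powrI[where b = "2 * k - 1"] tendsto_eq_intros) auto
    qed
    then show ?thesis using True by (simp add: isCont_def)
  qed
  then show ?thesis by (simp add: continuous_on_eq_continuous_at)
qed

section \<open>Continuously differentiable functions\<close>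

lemma C1_onI:
  assumes "\<And>p. p \<in> S \<Longrightarrow> (g has_derivative blinfun_apply (g' p)) (at p within S)"
    and "continuous_on S g'"
  shows "C1_on S g"
  using assms unfolding C1_on_def by blast

lemma C1_onE:
  assumes "C1_on S g"
  obtains g' where "\<And>p. p \<in> S \<Longrightarrow> (g has_derivative blinfun_apply (g' p)) (at p within S)"
    and "continuous_on S g'" "continuous_on S g"
proof -
  obtain g' where g': "\<forall>p\<in>S. (g has_derivative blinfun_apply (g' p)) (at p within S)" "continuous_on S g'"
    using assms unfolding C1_on_def by blast
  then have "continuous_on S g"
    by (auto simp: continuous_on_eq_continuous_within intro: has_derivative_continuous)
  then show thesis using that g' by blast
qed

lemma C1_on_imp_continuous_on: "C1_on S g \<Longrightarrow> continuous_on S g"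
  by (erule C1_onE)

lemma C1_on_linear:
  assumes "bounded_linear g"
  shows "C1_on S g"
  by (rule C1_onI[where g' = "\<lambda>_. Blinfun g"])
    (use assms in \<open>auto simp: bounded_linear_Blinfun_apply intro: bounded_linear_imp_has_derivative\<close>)

lemma C1_on_const: "C1_on S (\<lambda>_. c)"
  by (rule C1_onI[where g' = "\<lambda>_. 0"]) (auto simp: zero_blinfun.rep_eq)

lemma C1_on_add:
  assumes "C1_on S f" "C1_on S g"
  shows "C1_on S (\<lambda>p. f p + g p)"
proof -
  obtain f' where f': "\<And>p. p \<in> S \<Longrightarrow> (f has_derivative blinfun_apply (f' p)) (at p within S)"
    "continuous_on S f'" "continuous_on S f" using assms(1) by (rule C1_onE) blast
  obtain g' where g': "\<And>p. p \<in> S \<Longrightarrow> (g has_derivative blinfun_apply (g' p)) (at p within S)"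
    "continuous_on S g'" "continuous_on S g" using assms(2) by (rule C1_onE) blast
  show ?thesis
    by (intro C1_onI[where g' = "\<lambda>p. f' p + g' p"])
      (use f' g' in \<open>auto intro!: derivative_eq_intros continuous_intros simp: blinfun.add_left\<close>)
qed

lemma C1_on_compose:
  assumes "C1_on U f" "C1_on S g" "g ` S \<subseteq> U"
  shows "C1_on S (\<lambda>p. f (g p))"
proof -
  obtain f' where f': "\<And>p. p \<in> U \<Longrightarrow> (f has_derivative blinfun_apply (f' p)) (at p within U)"
    "continuous_on U f'" "continuous_on U f" using assms(1) by (rule C1_onE) blast
  obtain g' where g': "\<And>p. p \<in> S \<Longrightarrow> (g has_derivative blinfun_apply (g' p)) (at p within S)"
    "continuous_on S g'" "continuous_on S g" using assms(2) by (rule C1_onE) blast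
  show ?thesis
  proof (rule C1_onI)
    show "((\<lambda>p. f (g p)) has_derivative blinfun_apply (f' (g p) o\<^sub>L g' p)) (at p within S)" if "p \<in> S" for p
      using has_derivative_in_compose2[OF f'(1) assms(3) that g'(1)[OF that]]
      by (simp add: blinfun_compose.rep_eq o_def)
    show "continuous_on S (\<lambda>p. f' (g p) o\<^sub>L g' p)"
      using continuous_on_compose2[OF f'(2) g'(3) assms(3)] g'(2)
      by (intro bounded_bilinear.continuous_on[OF bounded_bilinear_blinfun_compose])
  qed
qed

lemma C1_on_scaleR:
  assumes "C1_on S f" "C1_on S g"
  shows "C1_on S (\<lambda>p. f p *\<^sub>R g p)"
proof -
  obtain f' where f': "\<And>p. p \<in> S \<Longrightarrow> (f has_derivative blinfun_apply (f' p)) (at p within S)"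
    "continuous_on S f'" "continuous_on S f" using assms(1) by (rule C1_onE) blast
  obtain g' where g': "\<And>p. p \<in> S \<Longrightarrow> (g has_derivative blinfun_apply (g' p)) (at p within S)"
    "continuous_on S g'" "continuous_on S g" using assms(2) by (rule C1_onE) blast
  show ?thesis
  proof (rule C1_onI)
    show "((\<lambda>p. f p *\<^sub>R g p) has_derivative
        blinfun_apply (f p *\<^sub>R g' p + (blinfun_scaleR_left (g p) o\<^sub>L f' p))) (at p within S)" if "p \<in> S" for p
      using has_derivative_scaleR[OF f'(1) g'(1)] that
      by (simp add: blinfun.bilinear_simps scaleR_blinfun.rep_eq plus_blinfun.rep_eq o_def)
    show "continuous_on S (\<lambda>p. f p *\<^sub>R g' p + (blinfun_scaleR_left (g p) o\<^sub>L f' p))"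
      using f' g'
      by (intro continuous_intros bounded_bilinear.continuous_on[OF bounded_bilinear_blinfun_compose]
          bounded_linear.continuous_on[OF bounded_linear_blinfun_scaleR_left])
  qed
qed

lemma C1_on_mult:
  fixes f g :: "'a::real_normed_vector \<Rightarrow> real"
  assumes "C1_on S f" "C1_on S g"
  shows "C1_on S (\<lambda>p. f p * g p)"
  using C1_on_scaleR[OF assms] by simp

lemma C1_on_real:
  fixes f f' :: "real \<Rightarrow> real"
  assumes "\<And>s. s \<in> S \<Longrightarrow> (f has_real_derivative f' s) (at s within S)" and "continuous_on S f'"
  shows "C1_on S f"
  by (rule C1_onI[where g' = "\<lambda>s. f' s *\<^sub>R id_blinfun"])
    (use assms in \<open>auto intro!: continuous_intros simp: has_field_derivative_def scaleR_blinfun.rep_eq\<close>)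

lemma C1_on_inverse:
  fixes g :: "'a::real_normed_vector \<Rightarrow> real"
  assumes "C1_on S g" "\<And>p. p \<in> S \<Longrightarrow> g p \<noteq> 0"
  shows "C1_on S (\<lambda>p. inverse (g p))"
proof (rule C1_on_compose[OF _ assms(1)])
  show "C1_on (- {0}) (inverse :: real \<Rightarrow> real)"
    by (rule C1_on_real[where f' = "\<lambda>x. - (inverse x ^ 2)"])
      (auto intro!: derivative_eq_intros continuous_intros simp: power2_eq_square)
qed (use assms(2) in auto)

lemma C1_on_inner_self: "C1_on S (\<lambda>w::'a::real_inner. w \<bullet> w)"
  by (rule C1_onI[where g' = "\<lambda>w. blinfun_inner_right (2 *\<^sub>R w)"])
    (auto intro!: derivative_eq_intros continuous_intros bounded_linear.continuous_on[OF bounded_linear_blinfun_inner_right]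
      simp: inner_commute)

lemma C1_on_inner_powr:
  fixes k :: real
  assumes "k > 1 / 2"
  shows "C1_on UNIV (\<lambda>w::'a::real_inner. (w \<bullet> w) powr k)"
proof (rule C1_onI)
  show "((\<lambda>w::'a. (w \<bullet> w) powr k) has_derivative
      blinfun_apply (blinfun_inner_right ((2 * k) *\<^sub>R ((w \<bullet> w) powr (k - 1) *\<^sub>R w)))) (at w within UNIV)" for w
    by (rule has_derivative_eq_rhs[OF has_derivative_inner_powr[OF assms]]) (auto simp: mult.assoc)
  show "continuous_on UNIV (\<lambda>w::'a. blinfun_inner_right ((2 * k) *\<^sub>R ((w \<bullet> w) powr (k - 1) *\<^sub>R w)))"
    by (intro bounded_linear.continuous_on[OF bounded_linear_blinfun_inner_right]
        continuous_on_scaleR continuous_on_const continuous_on_inner_powr_scaleR assms)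
qed

section \<open>Flows driven by the Emden system\<close>

text \<open>With the product rule in this form, the mass equation becomes algebra in the values of
  two Frechet derivatives on basis vectors.\<close>

lemma divergence_scaleR:
  assumes "p \<in> slab T" "(\<rho> has_derivative D\<rho>) (at p within slab T)" "(u has_derivative Du) (at p within slab T)"
  shows "divergence (\<lambda>q. \<rho> q *\<^sub>R u q) p =
    (\<Sum>i\<in>UNIV. \<rho> p * Du (0, axis i 1) $ i + D\<rho> (0, axis i 1) * u p $ i)"
proof -
  have "((\<lambda>q. (\<rho> q *\<^sub>R u q) $ i) has_derivative (\<lambda>h. \<rho> p * Du h $ i + D\<rho> h * u p $ i)) (at p within slab T)" for i
    using bounded_linear.has_derivative[OF bounded_linear_vec_nth has_derivative_scaleR[OF assms(2,3)], of i] by simp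
  from d_space_has_derivative[OF assms(1) this] show ?thesis
    by (simp add: divergence_def)
qed

text \<open>The right-hand sides are rewritten in terms of \<open>(a\<^sup>2 b)\<^bsup>-\<gamma>\<^esup>\<close>, the time factor of the pressure.\<close>

locale emden_flow =
  fixes \<gamma> \<xi> lam :: real and T :: ereal and a a' b b' :: "real \<Rightarrow> real"
  assumes T_pos: "T > 0"
    and a_pos: "t \<in> time_interval T \<Longrightarrow> a t > 0"
    and b_pos: "t \<in> time_interval T \<Longrightarrow> b t > 0"
    and deriv_a: "t \<in> time_interval T \<Longrightarrow> (a has_real_derivative a' t) (at t within time_interval T)"
    and deriv_b: "t \<in> time_interval T \<Longrightarrow> (b has_real_derivative b' t) (at t within time_interval T)"
    and deriv_a': "t \<in> time_interval T \<Longrightarrow> (a' has_real_derivative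
      \<xi>^2 / a t ^ 3 + lam * a t * b t * ((a t)\<^sup>2 * b t) powr (- \<gamma>)) (at t within time_interval T)"
    and deriv_b': "t \<in> time_interval T \<Longrightarrow> (b' has_real_derivative
      lam * (a t)\<^sup>2 * ((a t)\<^sup>2 * b t) powr (- \<gamma>)) (at t within time_interval T)"
begin

lemma has_derivative_similarity:
  assumes p: "p \<in> slab T"
  shows "(similarity_var a b has_derivative
    (\<lambda>h. (2 * snd p$1 * snd h$1 + 2 * snd p$2 * snd h$2) / (a (fst p))\<^sup>2 + 2 * snd p$3 * snd h$3 / (b (fst p))\<^sup>2
      - 2 * (a' (fst p) * ((snd p$1)\<^sup>2 + (snd p$2)\<^sup>2) / a (fst p) ^ 3 + b' (fst p) * (snd p$3)\<^sup>2 / b (fst p) ^ 3) * fst h))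
    (at p within slab T)"
proof -
  have t: "fst p \<in> time_interval T" using p by (auto simp: slab_def)
  \<comment> \<open>Splitting off the time coefficients of \<open>s\<close> leaves products of a
    function of time and a polynomial in space.\<close>
  define ia ib where "ia t = 1 / (a t)\<^sup>2" and "ib t = 1 / (b t)\<^sup>2" for t
  have 1: "(ia has_real_derivative - 2 * a' (fst p) / a (fst p) ^ 3) (at (fst p) within time_interval T)"
    unfolding ia_def using a_pos[OF t]
    by (auto intro!: derivative_eq_intros deriv_a[OF t] simp: field_simps power_numeral_reduce)
  have 2: "(ib has_real_derivative - 2 * b' (fst p) / b (fst p) ^ 3) (at (fst p) within time_interval T)"
    unfolding ib_def using b_pos[OF t]
    by (auto intro!: derivative_eq_intros deriv_b[OF t] simp: field_simps power_numeral_reduce)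
  have "similarity_var a b = (\<lambda>q. ((snd q$1)\<^sup>2 + (snd q$2)\<^sup>2) * ia (fst q) + (snd q$3)\<^sup>2 * ib (fst q))"
    by (auto simp: similarity_var_def ia_def ib_def)
  moreover have "(\<dots> has_derivative
    (\<lambda>h. (2 * snd p$1 * snd h$1 + 2 * snd p$2 * snd h$2) * ia (fst p) + 2 * snd p$3 * snd h$3 * ib (fst p)
      - 2 * (a' (fst p) * ((snd p$1)\<^sup>2 + (snd p$2)\<^sup>2) / a (fst p) ^ 3 + b' (fst p) * (snd p$3)\<^sup>2 / b (fst p) ^ 3) * fst h))
    (at p within slab T)"
    by (auto intro!: derivative_eq_intros has_derivative_time[OF p 1] has_derivative_time[OF p 2]
        simp: algebra_simps add_divide_distrib)
  ultimately show ?thesis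
    by (simp add: ia_def ib_def)
qed

text \<open>The primed constants are the time derivatives of the coefficients \<open>a' / a\<close>,
  \<open>\<xi> / a^2\<close> and \<open>b' / b\<close>, with the second derivatives of
  \<open>a\<close> and \<open>b\<close> eliminated by the Emden system.\<close>

lemma has_derivative_velocity:
  fixes p :: "real \<times> (real^3)"
  defines "t \<equiv> fst p" and "x \<equiv> snd p"
  assumes p: "p \<in> slab T"
    and H': "H' = \<xi>\<^sup>2 / a t ^ 4 + lam * b t * ((a t)\<^sup>2 * b t) powr (- \<gamma>) - (a' t / a t)\<^sup>2"
    and \<beta>': "\<beta>' = - 2 * \<xi> * a' t / a t ^ 3"
    and L': "L' = lam * (a t)\<^sup>2 * ((a t)\<^sup>2 * b t) powr (- \<gamma>) / b t - (b' t / b t)\<^sup>2"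
  shows "(velocity \<xi> a a' b b' has_derivative
    (\<lambda>h. vector [a' t / a t * snd h$1 - \<xi> / (a t)\<^sup>2 * snd h$2 + (H' * x$1 - \<beta>' * x$2) * fst h,
                 \<xi> / (a t)\<^sup>2 * snd h$1 + a' t / a t * snd h$2 + (\<beta>' * x$1 + H' * x$2) * fst h,
                 b' t / b t * snd h$3 + L' * x$3 * fst h])) (at p within slab T)"
proof -
  have t: "t \<in> time_interval T" using p by (auto simp: slab_def t_def)
  note [simp] = a_pos[OF t, THEN less_imp_neq, symmetric] b_pos[OF t, THEN less_imp_neq, symmetric]
  define H \<beta> L where "H t = a' t / a t" and "\<beta> t = \<xi> / (a t)\<^sup>2" and "L t = b' t / b t" for t
  have 1: "(H has_real_derivative H') (at (fst p) within time_interval T)"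
    unfolding H_def using a_pos[OF t]
    by (auto intro!: derivative_eq_intros deriv_a[OF t] deriv_a'[OF t] simp: H' field_simps power_numeral_reduce
      simp flip: t_def)
  have 2: "(\<beta> has_real_derivative \<beta>') (at (fst p) within time_interval T)"
    unfolding \<beta>_def using a_pos[OF t]
    by (auto intro!: derivative_eq_intros deriv_a[OF t] simp: \<beta>' field_simps power_numeral_reduce
      simp flip: t_def)
  have 3: "(L has_real_derivative L') (at (fst p) within time_interval T)"
    unfolding L_def using b_pos[OF t]
    by (auto intro!: derivative_eq_intros deriv_b[OF t] deriv_b'[OF t] simp: L' field_simps power_numeral_reduce
      simp flip: t_def)
  have "velocity \<xi> a a' b b' = (\<lambda>q.
      (H (fst q) * snd q$1 - \<beta> (fst q) * snd q$2) *\<^sub>R axis 1 1 +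
      (\<beta> (fst q) * snd q$1 + H (fst q) * snd q$2) *\<^sub>R axis 2 1 +
      (L (fst q) * snd q$3) *\<^sub>R axis 3 1)"
    by (auto simp: velocity_def vector_3_eq_sum H_def \<beta>_def L_def)
  moreover have "(\<dots> has_derivative (\<lambda>h.
      (H t * snd h$1 - \<beta> t * snd h$2 + (H' * x$1 - \<beta>' * x$2) * fst h) *\<^sub>R axis 1 1 +
      (\<beta> t * snd h$1 + H t * snd h$2 + (\<beta>' * x$1 + H' * x$2) * fst h) *\<^sub>R axis 2 1 +
      (L t * snd h$3 + L' * x$3 * fst h) *\<^sub>R axis 3 1)) (at p within slab T)"
    by (auto intro!: derivative_eq_intros has_derivative_time[OF p 1] has_derivative_time[OF p 2] has_derivative_time[OF p 3]
        simp: algebra_simps t_def x_def)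
  ultimately show ?thesis
    by (simp add: vector_3_eq_sum H_def \<beta>_def L_def)
qed

text \<open>Regularity of \<open>f\<close> is asked only at the value of \<open>s\<close> at
  \<open>p\<close>, so that bad points can be excised later. The derivative of
  \<open>f powr \<gamma>\<close> is a separate hypothesis because the chain rule for
  \<open>powr\<close> wants a positive base, while \<open>f\<close> may vanish.\<close>

lemma euler_equations_at_similarity_flow:
  fixes f :: "real \<Rightarrow> real"
  assumes p: "p \<in> slab T" and f0: "\<And>s. f s \<ge> 0"
    and df: "(f has_real_derivative df) (at (similarity_var a b p))"
    and dg: "((\<lambda>s. f s powr \<gamma>) has_real_derivative dg) (at (similarity_var a b p))"
    and eq: "K * dg = - (lam / 2) * f (similarity_var a b p)"
  shows "euler_equations_at K \<gamma> T (\<lambda>q. f (similarity_var a b q) / ((a (fst q))\<^sup>2 * b (fst q))) (velocity \<xi> a a' b b') p"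
proof -
  define t x where "t = fst p" and "x = snd p"
  have t: "t \<in> time_interval T" using p by (auto simp: slab_def t_def)
  define A A' B B' where "A = a t" "A' = a' t" "B = b t" "B' = b' t"
  have AB: "A > 0" "B > 0" using a_pos[OF t] b_pos[OF t] by (auto simp: A_A'_B_B'_def)
  define P where "P = (A\<^sup>2 * B) powr (- \<gamma>)"
  define s where "s = similarity_var a b p"
  define Ds where "Ds = (\<lambda>h :: real \<times> (real^3). (2 * x$1 * snd h$1 + 2 * x$2 * snd h$2) / A\<^sup>2 + 2 * x$3 * snd h$3 / B\<^sup>2
      - 2 * (A' * ((x$1)\<^sup>2 + (x$2)\<^sup>2) / A ^ 3 + B' * (x$3)\<^sup>2 / B ^ 3) * fst h)"
  have Ds: "(similarity_var a b has_derivative Ds) (at p within slab T)"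
    using has_derivative_similarity[OF p] unfolding Ds_def x_def A_A'_B_B'_def t_def .
  define H' \<beta>' L' where "H' = \<xi>\<^sup>2 / A ^ 4 + lam * B * P - (A' / A)\<^sup>2"
    and "\<beta>' = - 2 * \<xi> * A' / A ^ 3" and "L' = lam * A\<^sup>2 * P / B - (B' / B)\<^sup>2"
  define Du where "Du = (\<lambda>h :: real \<times> (real^3). vector
     [A' / A * snd h$1 - \<xi> / A\<^sup>2 * snd h$2 + (H' * x$1 - \<beta>' * x$2) * fst h,
      \<xi> / A\<^sup>2 * snd h$1 + A' / A * snd h$2 + (\<beta>' * x$1 + H' * x$2) * fst h,
      B' / B * snd h$3 + L' * x$3 * fst h] :: real^3)"
  have Du: "(velocity \<xi> a a' b b' has_derivative Du) (at p within slab T)"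
    unfolding Du_def A_A'_B_B'_def t_def x_def
    by (rule has_derivative_velocity[OF p]) (simp_all add: H'_def \<beta>'_def L'_def P_def A_A'_B_B'_def t_def)
  have u: "velocity \<xi> a a' b b' p = vector [A' / A * x$1 - \<xi> / A\<^sup>2 * x$2, \<xi> / A\<^sup>2 * x$1 + A' / A * x$2, B' / B * x$3]"
    by (auto simp: velocity_def A_A'_B_B'_def t_def x_def split: prod.split)

  \<comment> \<open>The time factor of the density; \<open>2 * A' / A + B' / B\<close> is the
    divergence of the velocity.\<close>
  define m where "m t = 1 / ((a t)\<^sup>2 * b t)" for t
  have m: "(m has_real_derivative - (2 * A' / A + B' / B) * m t) (at t within time_interval T)"
    unfolding m_def using AB
    by (auto intro!: derivative_eq_intros deriv_a[OF t] deriv_b[OF t] simp: A_A'_B_B'_def field_simps power_numeral_reduce)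
  define \<rho> where "\<rho> = (\<lambda>q. f (similarity_var a b q) / ((a (fst q))\<^sup>2 * b (fst q)))"
  define D\<rho> where "D\<rho> h = f s * (- (2 * A' / A + B' / B) * m t * fst h) + df * Ds h * m t" for h
  \<comment> \<open>Density and pressure are both a function of \<open>s\<close> times a function of
    time, so this rule serves for both.\<close>
  have comp: "((\<lambda>q. g (similarity_var a b q) * k (fst q)) has_derivative
      (\<lambda>h. g s * (k' * fst h) + g' * Ds h * k t)) (at p within slab T)"
    if "(g has_real_derivative g') (at s)" "(k has_real_derivative k') (at t within time_interval T)" for g g' k k'
  proof -
    have "((\<lambda>q. g (similarity_var a b q)) has_derivative (\<lambda>h. g' * Ds h)) (at p within slab T)"
      using has_derivative_compose[OF Ds] that(1) by (simp add: has_field_derivative_def s_def)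
    from has_derivative_mult[OF this has_derivative_time[OF p that(2)[unfolded t_def]]]
    show ?thesis by (simp add: s_def t_def)
  qed
  have D\<rho>: "(\<rho> has_derivative D\<rho>) (at p within slab T)"
    using comp[OF df[folded s_def] m] by (simp add: \<rho>_def D\<rho>_def[abs_def] m_def)
  have \<rho>: "\<rho> p = f s * m t" by (simp add: \<rho>_def s_def m_def t_def)

  have "((\<lambda>t. m t powr \<gamma>) has_real_derivative \<gamma> * m t powr (\<gamma> - 1) * (- (2 * A' / A + B' / B) * m t)) (at t within time_interval T)"
    using DERIV_chain2[OF has_real_derivative_powr m] AB by (simp add: m_def A_A'_B_B'_def)
  \<comment> \<open>Existence of \<open>M'\<close> suffices: only the spatial gradient of the
    pressure enters the momentum equation.\<close>
  then obtain M' where M': "((\<lambda>t. m t powr \<gamma>) has_real_derivative M') (at t within time_interval T)" by blast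
  have mP: "m t powr \<gamma> = P"
    by (simp add: m_def P_def A_A'_B_B'_def powr_minus powr_divide field_simps)
  define Dp where "Dp h = f s powr \<gamma> * (M' * fst h) + dg * Ds h * P" for h
  have Dp: "((\<lambda>q. \<rho> q powr \<gamma>) has_derivative Dp) (at p within slab T)"
  proof (rule has_derivative_transform[OF p])
    show "\<rho> q powr \<gamma> = f (similarity_var a b q) powr \<gamma> * (m (fst q) powr \<gamma>)" for q
      by (simp add: \<rho>_def m_def powr_divide)
    show "((\<lambda>q. f (similarity_var a b q) powr \<gamma> * (m (fst q) powr \<gamma>)) has_derivative Dp) (at p within slab T)"
      using comp[OF dg[folded s_def] M'] mP by (simp add: Dp_def[abs_def])
  qed

  \<comment> \<open>The terms with \<open>df\<close> cancel because \<open>Ds\<close> vanishes in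
    the direction of time 1 and the velocity at \<open>p\<close>; the others cancel because the
    logarithmic derivative of \<open>m\<close> is minus the divergence.\<close>
  have mass: "d_time T \<rho> p + divergence (\<lambda>q. \<rho> q *\<^sub>R velocity \<xi> a a' b b' q) p = 0"
    unfolding divergence_scaleR[OF p D\<rho> Du] d_time_has_derivative[OF T_pos p D\<rho>]
    using AB by (simp add: sum_3 D\<rho>_def Du_def Ds_def u \<rho> axis_def field_simps power_numeral_reduce)
  have mt: "m t = 1 / (A\<^sup>2 * B)" by (simp add: m_def A_A'_B_B'_def)
  have dg': "K * dg = - (lam / 2) * f s" using eq by (simp add: s_def)
  have momentum: "\<rho> p *\<^sub>R (d_time T (velocity \<xi> a a' b b') p + advect (velocity \<xi> a a' b b') (velocity \<xi> a a' b b') p)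
      + K *\<^sub>R grad (\<lambda>q. \<rho> q powr \<gamma>) p = 0"
  proof -
    \<comment> \<open>The horizontal cross terms vanish by the choice of \<open>\<beta>'\<close>.
      The diagonal coefficient is \<open>H' + (A' / A)^2 - \<xi>^2 / A ^ 4\<close>, which leaves
      only the term with \<open>lam\<close>.\<close>
    have acc: "d_time T (velocity \<xi> a a' b b') p + advect (velocity \<xi> a a' b b') (velocity \<xi> a a' b b') p
      = vector [lam * B * P * x$1, lam * B * P * x$2, lam * A\<^sup>2 * P / B * x$3]"
      unfolding advect_def d_time_has_derivative[OF T_pos p Du] d_space_has_derivative[OF p Du]
      using AB by (simp add: vec_eq_iff forall_3 sum_3 Du_def u axis_def H'_def \<beta>'_def L'_def field_simps power_numeral_reduce)
    have gr: "grad (\<lambda>q. \<rho> q powr \<gamma>) p = vector [dg * (2 * x$1 / A\<^sup>2) * P, dg * (2 * x$2 / A\<^sup>2) * P, dg * (2 * x$3 / B\<^sup>2) * P]"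
      unfolding grad_def d_space_has_derivative[OF p Dp]
      by (simp add: vec_eq_iff forall_3 Dp_def Ds_def axis_def)
    \<comment> \<open>Horizontal and vertical components all contain the residual
      \<open>lam / 2 * f s + K * dg\<close> of the profile equation as a factor.\<close>
    have "f s * (1 / (A\<^sup>2 * B)) * (lam * B * P * y) + K * (dg * (2 * y / A\<^sup>2) * P)
        = (lam / 2 * f s + K * dg) * (2 * y * P / A\<^sup>2)" for y
      using AB by (simp add: field_simps)
    moreover have "f s * (1 / (A\<^sup>2 * B)) * (lam * A\<^sup>2 * P / B * y) + K * (dg * (2 * y / B\<^sup>2) * P)
        = (lam / 2 * f s + K * dg) * (2 * y * P / B\<^sup>2)" for y
      using AB by (simp add: field_simps power_numeral_reduce)
    moreover have "lam / 2 * f s + K * dg = 0"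
      using dg' by simp
    ultimately show ?thesis
      unfolding acc gr \<rho> mt by (simp only: vec_eq_iff forall_3) simp
  qed
  show ?thesis
    unfolding euler_equations_at_def \<rho>_def[symmetric]
    using mass momentum D\<rho> Du Dp by (auto simp: differentiable_def)
qed

end

section \<open>The density profile\<close>

lemma profile_nonneg: "\<alpha> \<ge> 0 \<Longrightarrow> profile K \<gamma> lam \<alpha> s \<ge> 0"
  by (simp add: profile_def)

lemma continuous_on_profile:
  assumes "\<gamma> \<ge> 1" "K > 0"
  shows "continuous_on S (profile K \<gamma> lam \<alpha>)"
proof (cases "\<gamma> = 1")
  case True
  with assms show ?thesis
    unfolding profile_def by (auto intro!: continuous_intros)
next
  case False
  have "continuous_on S (\<lambda>s. max (- (lam * (\<gamma> - 1) / (2 * K * \<gamma>)) * s + \<alpha>) 0)"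
    using assms by (auto intro!: continuous_intros)
  \<comment> \<open>The exponent \<open>1 / (\<gamma> - 1)\<close> is positive, so the power is
    continuous also where the cut-off base is 0.\<close>
  from continuous_on_powr'[OF this continuous_on_const[of S "1 / (\<gamma> - 1)"]] False assms show ?thesis
    by (simp add: profile_def[abs_def])
qed

text \<open>For \<open>\<gamma> > 1\<close> and \<open>k = 1 / (\<gamma> - 1)\<close> one has
  \<open>k * \<gamma> = k + 1\<close>, so \<open>f powr \<gamma>\<close> is the same truncated base
  to the power \<open>k + 1\<close>. The slope \<open>c\<close> of the base is such that
  \<open>K * (k + 1) * c = - lam / 2\<close>.\<close>

lemma profile_pressure_ode:
  assumes "K > 0" "\<gamma> \<ge> 1" "\<alpha> \<ge> 0"
    and regular: "\<gamma> = 1 \<or> lam = 0 \<or> - (lam * (\<gamma> - 1) / (2 * K * \<gamma>)) * s + \<alpha> \<noteq> 0"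
  shows "\<exists>df dg. (profile K \<gamma> lam \<alpha> has_real_derivative df) (at s) \<and>
    ((\<lambda>s. profile K \<gamma> lam \<alpha> s powr \<gamma>) has_real_derivative dg) (at s) \<and>
    K * dg = - (lam / 2) * profile K \<gamma> lam \<alpha> s"
proof -
  consider "\<gamma> = 1" | "\<gamma> \<noteq> 1" "lam = 0" | "\<gamma> > 1" "- (lam * (\<gamma> - 1) / (2 * K * \<gamma>)) * s + \<alpha> \<noteq> 0"
    using assms by force
  then show ?thesis
  proof cases
    case 1
    define df where "df = \<alpha> * exp (- (lam / (2 * K)) * s) * - (lam / (2 * K))"
    have "(profile K \<gamma> lam \<alpha> has_real_derivative df) (at s)"
      unfolding profile_def df_def using 1 \<open>K > 0\<close> by (auto intro!: derivative_eq_intros)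
    moreover have "(\<lambda>s. profile K \<gamma> lam \<alpha> s powr \<gamma>) = profile K \<gamma> lam \<alpha>"
      using 1 profile_nonneg[OF \<open>\<alpha> \<ge> 0\<close>] by (auto simp: powr_one)
    moreover have "K * df = - (lam / 2) * profile K \<gamma> lam \<alpha> s"
      using 1 \<open>K > 0\<close> by (simp add: df_def profile_def)
    ultimately show ?thesis by metis
  next
    \<comment> \<open>The profile is constant here, which covers \<open>\<alpha> = 0\<close>, where
      the base vanishes for every \<open>s\<close>.\<close>
    case 2
    then have "profile K \<gamma> lam \<alpha> = (\<lambda>s. max \<alpha> 0 powr (1 / (\<gamma> - 1)))"
      by (auto simp: profile_def)
    then show ?thesis using 2 by (auto intro!: exI[of _ 0])
  next
    case 3
    define k c where "k = 1 / (\<gamma> - 1)" and "c = - (lam * (\<gamma> - 1) / (2 * K * \<gamma>))"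
    have "k > 0" using 3 by (simp add: k_def)
    have f: "profile K \<gamma> lam \<alpha> = (\<lambda>s. max (c * s + \<alpha>) 0 powr k)"
      using 3 by (auto simp: profile_def k_def c_def)
    have k\<gamma>: "k * \<gamma> = k + 1" using 3 by (simp add: k_def field_simps)
    have base: "((\<lambda>s. c * s + \<alpha>) has_real_derivative c) (at s)"
      by (auto intro!: derivative_eq_intros)
    have D: "((\<lambda>s. max (c * s + \<alpha>) 0 powr e) has_real_derivative e * max (c * s + \<alpha>) 0 powr (e - 1) * c) (at s)"
      if "e > 0" for e
      using DERIV_chain2[OF has_derivative_max_powr[OF that] base] 3 by (simp add: c_def)
    have "K * ((k + 1) * max (c * s + \<alpha>) 0 powr (k + 1 - 1) * c) = - (lam / 2) * max (c * s + \<alpha>) 0 powr k"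
    proof -
      have "K * ((k + 1) * c) = - (lam / 2)"
        using 3 \<open>K > 0\<close> by (simp add: k_def c_def field_simps)
      then have "K * ((k + 1) * c) * max (c * s + \<alpha>) 0 powr k = - (lam / 2) * max (c * s + \<alpha>) 0 powr k"
        by simp
      then show ?thesis by (simp only: mult_ac add_diff_cancel_right')
    qed
    then show ?thesis
      using D[OF \<open>k > 0\<close>] D[of "k + 1"] \<open>k > 0\<close> unfolding f powr_powr k\<gamma> by fastforce
  qed
qed

text \<open>The half-line contains all values of \<open>s\<close>. On it the base stays positive if
  \<open>lam < 0\<close> and \<open>\<alpha> > 0\<close>; if \<open>1 < \<gamma> < 2\<close>, the
  exponent exceeds 1 and the base may pass through 0. The case excluded by \<open>nz\<close> is a
  pure power of \<open>s\<close>, treated below in the variable \<open>w\<close>.\<close>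

lemma C1_on_profile:
  assumes "\<gamma> \<ge> 1" "K > 0" "\<alpha> \<ge> 0"
    and cases: "\<gamma> = 1 \<or> lam \<le> 0 \<or> \<gamma> < 2" and nz: "\<not> (\<gamma> > 1 \<and> \<alpha> = 0 \<and> lam < 0)"
  shows "C1_on {0..} (profile K \<gamma> lam \<alpha>)"
proof -
  consider "\<gamma> = 1" | "\<gamma> \<noteq> 1" "lam = 0" | "\<gamma> > 1" "lam < 0 \<and> \<alpha> > 0 \<or> \<gamma> < 2"
    using assms by force
  then show ?thesis
  proof cases
    case 1
    show ?thesis
      by (rule C1_on_real[where f' = "\<lambda>s. \<alpha> * exp (- (lam / (2 * K)) * s) * - (lam / (2 * K))"])
        (use 1 \<open>K > 0\<close> in \<open>auto intro!: derivative_eq_intros continuous_intros simp: profile_def[abs_def]\<close>)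
  next
    case 2
    then have "profile K \<gamma> lam \<alpha> = (\<lambda>s. max \<alpha> 0 powr (1 / (\<gamma> - 1)))"
      by (auto simp: profile_def)
    then show ?thesis using C1_on_const by metis
  next
    case 3
    define k c where "k = 1 / (\<gamma> - 1)" and "c = - (lam * (\<gamma> - 1) / (2 * K * \<gamma>))"
    have "k > 0" using 3 by (simp add: k_def)
    have f: "profile K \<gamma> lam \<alpha> = (\<lambda>s. max (c * s + \<alpha>) 0 powr k)"
      using 3 by (auto simp: profile_def k_def c_def)
    have "c > 0" if "lam < 0"
      using 3 \<open>K > 0\<close> that by (simp add: c_def mult_neg_pos divide_neg_pos)
    then have regular: "c * s + \<alpha> > 0 \<or> k > 1" if "s \<ge> 0" for s
      using 3 that by (auto simp: k_def add_nonneg_pos)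
    show ?thesis
      unfolding f
    proof (rule C1_on_real)
      fix s :: real assume "s \<in> {0..}"
      then have "c * s + \<alpha> \<noteq> 0 \<or> k > 1" using regular[of s] by auto
      moreover have "((\<lambda>s. c * s + \<alpha>) has_real_derivative c) (at s within {0..})"
        by (auto intro!: derivative_eq_intros)
      ultimately show "((\<lambda>s. max (c * s + \<alpha>) 0 powr k) has_real_derivative
          k * max (c * s + \<alpha>) 0 powr (k - 1) * c) (at s within {0..})"
        by (rule DERIV_chain2[OF has_derivative_max_powr[OF \<open>k > 0\<close>]])
    next
      show "continuous_on {0..} (\<lambda>s. k * max (c * s + \<alpha>) 0 powr (k - 1) * c)"
      proof -
        have "continuous_on {0..} (\<lambda>s. max (c * s + \<alpha>) 0)"
          by (intro continuous_intros)
        \<comment> \<open>A zero base is admissible for continuity only with a positive exponent,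
          and the derivative has exponent \<open>k - 1\<close>.\<close>
        moreover have "max (c * s + \<alpha>) 0 \<ge> 0 \<and> (max (c * s + \<alpha>) 0 = 0 \<longrightarrow> k - 1 > 0)" if "s \<in> {0..}" for s
          using regular[of s] that by auto
        ultimately show ?thesis
          by (intro continuous_on_mult continuous_on_const continuous_on_powr') auto
      qed
    qed
  qed
qed

text \<open>A pure power of \<open>s\<close> with exponent \<open>k\<close> is the norm of
  \<open>w\<close> to the power \<open>2 * k\<close>, so in this variable \<open>k > 1 / 2\<close>,
  that is \<open>\<gamma> < 3\<close>, is enough.\<close>

lemma C1_on_profile_inner:
  assumes "\<gamma> \<ge> 1" "K > 0" "\<alpha> \<ge> 0"
    and "\<gamma> = 1 \<or> lam \<le> 0 \<or> \<gamma> < 2" and "\<not> (\<alpha> = 0 \<and> lam < 0 \<and> \<gamma> \<ge> 3)"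
  shows "C1_on UNIV (\<lambda>w::'a::real_inner. profile K \<gamma> lam \<alpha> (w \<bullet> w))"
proof (cases "\<gamma> > 1 \<and> \<alpha> = 0 \<and> lam < 0")
  case False
  show ?thesis
    by (rule C1_on_compose[OF C1_on_profile C1_on_inner_self]) (use assms False in auto)
next
  case True
  define k c where "k = 1 / (\<gamma> - 1)" and "c = - (lam * (\<gamma> - 1) / (2 * K * \<gamma>))"
  have "c > 0" using True \<open>K > 0\<close> by (simp add: c_def mult_neg_pos divide_neg_pos)
  have "profile K \<gamma> lam \<alpha> (w \<bullet> w) = c powr k * (w \<bullet> w) powr k" for w :: 'a
  proof -
    have "profile K \<gamma> lam \<alpha> (w \<bullet> w) = max (c * (w \<bullet> w)) 0 powr k"
      using True by (simp add: profile_def k_def c_def)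
    also have "max (c * (w \<bullet> w)) 0 = c * (w \<bullet> w)" using \<open>c > 0\<close> by simp
    finally show ?thesis by (simp add: powr_mult)
  qed
  moreover have "k > 1 / 2" using True assms(5) by (simp add: k_def field_simps)
  ultimately show ?thesis
    by (simp add: C1_on_mult C1_on_const C1_on_inner_powr)
qed

section \<open>Regularity and the exceptional set\<close>

context emden_flow
begin

text \<open>This rescaling turns the moving ellipsoids of constant \<open>s\<close> into fixed
  spheres.\<close>

definition scaled_position :: "real \<times> (real^3) \<Rightarrow> real^3" where
  "scaled_position = (\<lambda>(t, x). vector [x$1 / a t, x$2 / a t, x$3 / b t])"

lemma similarity_var_eq: "similarity_var a b q = scaled_position q \<bullet> scaled_position q"
  by (auto simp: similarity_var_def scaled_position_def inner_vec_def sum_3 power2_eq_square add_divide_distrib split: prod.split)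

section \<open>Smoothness of the coefficients, the velocity and the density\<close>

lemma C1_on_time:
  fixes f f' :: "real \<Rightarrow> real"
  assumes "\<And>t. t \<in> time_interval T \<Longrightarrow> (f has_real_derivative f' t) (at t within time_interval T)"
    and "continuous_on (time_interval T) f'"
  shows "C1_on (slab T) (\<lambda>q. f (fst q))"
  by (rule C1_on_compose[OF C1_on_real C1_on_linear[OF bounded_linear_fst]]) (use assms in \<open>auto simp: slab_def\<close>)

lemma C1_on_coord: "C1_on S (\<lambda>q::real \<times> (real^3). snd q $ i)"
  by (intro C1_on_linear bounded_linear_compose[OF bounded_linear_vec_nth bounded_linear_snd])

lemma continuous_coefficients:
  "continuous_on (time_interval T) a" "continuous_on (time_interval T) b"
  "continuous_on (time_interval T) a'" "continuous_on (time_interval T) b'"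
  by (rule DERIV_continuous_on, erule deriv_a, rule DERIV_continuous_on, erule deriv_b,
      rule DERIV_continuous_on, erule deriv_a', rule DERIV_continuous_on, erule deriv_b')

text \<open>For \<open>a'\<close> and \<open>b'\<close> continuous second derivatives are needed;
  they are the right-hand sides of the Emden system, continuous since \<open>a\<close> and
  \<open>b\<close> are positive.\<close>

lemma C1_on_coefficients:
  "C1_on (slab T) (\<lambda>q. a (fst q))" "C1_on (slab T) (\<lambda>q. b (fst q))"
  "C1_on (slab T) (\<lambda>q. a' (fst q))" "C1_on (slab T) (\<lambda>q. b' (fst q))"
proof -
  have nz: "\<forall>t\<in>time_interval T. a t \<noteq> 0" "\<forall>t\<in>time_interval T. b t \<noteq> 0"
    "\<forall>t\<in>time_interval T. (a t)\<^sup>2 * b t \<noteq> 0"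
    using a_pos b_pos by force+
  have "continuous_on (time_interval T) (\<lambda>t. ((a t)\<^sup>2 * b t) powr (- \<gamma>))"
    using nz by (intro continuous_on_powr continuous_intros continuous_coefficients) auto
  then show "C1_on (slab T) (\<lambda>q. a' (fst q))" "C1_on (slab T) (\<lambda>q. b' (fst q))"
    using nz by (intro C1_on_time[OF deriv_a'] C1_on_time[OF deriv_b'] continuous_intros continuous_coefficients; simp)+
qed (intro C1_on_time[OF deriv_a continuous_coefficients(3)] C1_on_time[OF deriv_b continuous_coefficients(4)]; assumption)+

lemma C1_on_inverse_coefficients:
  "C1_on (slab T) (\<lambda>q. inverse (a (fst q)))" "C1_on (slab T) (\<lambda>q. inverse (b (fst q)))"
proof -
  have "a (fst q) \<noteq> 0" "b (fst q) \<noteq> 0" if "q \<in> slab T" for q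
    using that a_pos[of "fst q"] b_pos[of "fst q"] by (auto simp: slab_def)
  then show "C1_on (slab T) (\<lambda>q. inverse (a (fst q)))" "C1_on (slab T) (\<lambda>q. inverse (b (fst q)))"
    by (auto intro: C1_on_inverse C1_on_coefficients)
qed

lemma C1_on_velocity: "C1_on (slab T) (velocity \<xi> a a' b b')"
proof -
  have "velocity \<xi> a a' b b' = (\<lambda>q.
      (a' (fst q) * inverse (a (fst q)) * snd q$1 + (- \<xi>) * inverse (a (fst q)) * inverse (a (fst q)) * snd q$2) *\<^sub>R axis 1 1 +
      (\<xi> * inverse (a (fst q)) * inverse (a (fst q)) * snd q$1 + a' (fst q) * inverse (a (fst q)) * snd q$2) *\<^sub>R axis 2 1 +
      (b' (fst q) * inverse (b (fst q)) * snd q$3) *\<^sub>R axis 3 1)"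
    by (auto simp: velocity_def vector_3_eq_sum divide_inverse power2_eq_square fun_eq_iff mult.assoc)
  then show ?thesis
    by (simp only:) (intro C1_on_add C1_on_scaleR C1_on_mult C1_on_const C1_on_coord C1_on_coefficients C1_on_inverse_coefficients)
qed

lemma C1_on_scaled_position: "C1_on (slab T) scaled_position"
proof -
  have "scaled_position = (\<lambda>q. (snd q$1 * inverse (a (fst q))) *\<^sub>R axis 1 1 +
      (snd q$2 * inverse (a (fst q))) *\<^sub>R axis 2 1 + (snd q$3 * inverse (b (fst q))) *\<^sub>R axis 3 1)"
    by (auto simp: scaled_position_def vector_3_eq_sum divide_inverse)
  then show ?thesis
    by (simp only:) (intro C1_on_add C1_on_scaleR C1_on_mult C1_on_const C1_on_coord C1_on_inverse_coefficients)
qed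

lemma gas_density_eq:
  "gas_density K \<gamma> lam \<alpha> a b = (\<lambda>q. profile K \<gamma> lam \<alpha> (similarity_var a b q) / ((a (fst q))\<^sup>2 * b (fst q)))"
  by (auto simp: gas_density_def)

lemma C1_on_gas_density:
  assumes "C1_on UNIV (\<lambda>w::real^3. profile K \<gamma> lam \<alpha> (w \<bullet> w))"
  shows "C1_on (slab T) (gas_density K \<gamma> lam \<alpha> a b)"
proof -
  have "gas_density K \<gamma> lam \<alpha> a b = (\<lambda>q. profile K \<gamma> lam \<alpha> (scaled_position q \<bullet> scaled_position q) *
      (inverse (a (fst q)) * inverse (a (fst q)) * inverse (b (fst q))))"
    by (auto simp: gas_density_eq similarity_var_eq divide_inverse power2_eq_square)
  then show ?thesis
    using C1_on_compose[OF assms C1_on_scaled_position]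
    by (simp only:) (intro C1_on_mult C1_on_inverse_coefficients; simp)
qed

lemma continuous_on_gas_density:
  assumes "\<gamma> \<ge> 1" "K > 0"
  shows "continuous_on (slab T) (gas_density K \<gamma> lam \<alpha> a b)"
proof -
  have "continuous_on (slab T) (similarity_var a b)"
    unfolding similarity_var_eq[abs_def]
    by (intro continuous_intros C1_on_imp_continuous_on C1_on_scaled_position)
  then have "continuous_on (slab T) (\<lambda>q. profile K \<gamma> lam \<alpha> (similarity_var a b q))"
    by (rule continuous_on_compose2[OF continuous_on_profile[OF assms, of UNIV]]) simp
  moreover have "(a (fst q))\<^sup>2 * b (fst q) \<noteq> 0" if "q \<in> slab T" for q
    using that a_pos[of "fst q"] b_pos[of "fst q"] by (auto simp: slab_def)
  ultimately show ?thesis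
    unfolding gas_density_eq
    using C1_on_coefficients(1,2)[THEN C1_on_imp_continuous_on]
    by (intro continuous_intros) auto
qed

section \<open>Measure of the level sets of \<open>s\<close>\<close>

text \<open>The level set is the image of \<open>[0, T) \<times> sphere\<close> under the fibrewise linear rescaling \<open>\<Phi>\<close>.\<close>

lemma negligible_similarity_level: "negligible {p \<in> slab T. similarity_var a b p = r}"
proof -
  define \<Phi> :: "real \<times> (real^3) \<Rightarrow> real \<times> (real^3)"
    where "\<Phi> q = (fst q, vector [a (fst q) * snd q$1, a (fst q) * snd q$2, b (fst q) * snd q$3])" for q
  define S where "S = time_interval T \<times> sphere (0::real^3) (sqrt r)"
  \<comment> \<open>A sphere times the time axis is the boundary of a convex cylinder, hence has
    measure zero. For \<open>r = 0\<close> the sphere is a point, for \<open>r < 0\<close> it is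
    empty since \<open>sqrt r < 0\<close>.\<close>
  have "negligible (frontier (UNIV \<times> cball (0::real^3) (sqrt r) :: (real \<times> (real^3)) set))"
    by (intro negligible_convex_frontier convex_Times) auto
  moreover have "S \<subseteq> frontier (UNIV \<times> cball (0::real^3) (sqrt r))"
    by (auto simp: S_def frontier_def closure_Times interior_Times)
  ultimately have "negligible S" by (rule negligible_subset)
  moreover have "\<Phi> differentiable_on S"
  proof -
    have "C1_on (slab T) (\<lambda>q. (a (fst q) * snd q$1) *\<^sub>R axis 1 (1::real) +
        (a (fst q) * snd q$2) *\<^sub>R axis 2 1 + (b (fst q) * snd q$3) *\<^sub>R (axis 3 1 :: real^3))"
      by (intro C1_on_add C1_on_scaleR C1_on_mult C1_on_const C1_on_coord C1_on_coefficients)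
    then have "(\<lambda>q. vector [a (fst q) * snd q$1, a (fst q) * snd q$2, b (fst q) * snd q$3] :: real^3) differentiable_on slab T"
      unfolding vector_3_eq_sum C1_on_def differentiable_on_def differentiable_def by blast
    then have "\<Phi> differentiable_on slab T"
      unfolding \<Phi>_def[abs_def] differentiable_on_def differentiable_def
      by (fast intro: has_derivative_Pair has_derivative_fst has_derivative_ident)
    then show ?thesis
      by (rule differentiable_on_subset) (auto simp: S_def slab_def)
  qed
  ultimately have "negligible (\<Phi> ` S)"
    by (intro negligible_differentiable_image_negligible) auto
  moreover have "{p \<in> slab T. similarity_var a b p = r} \<subseteq> \<Phi> ` S"
  proof
    fix p assume p: "p \<in> {p \<in> slab T. similarity_var a b p = r}"
    then have t: "fst p \<in> time_interval T" by (auto simp: slab_def)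
    have "p = \<Phi> (fst p, scaled_position p)"
      using a_pos[OF t] b_pos[OF t]
      by (cases p) (auto simp: \<Phi>_def scaled_position_def vec_eq_iff forall_3)
    moreover have "(fst p, scaled_position p) \<in> S"
      using p t by (auto simp: S_def norm_eq_sqrt_inner similarity_var_eq)
    ultimately show "p \<in> \<Phi> ` S" by blast
  qed
  ultimately show ?thesis by (rule negligible_subset)
qed

section \<open>The weak solution\<close>

lemma euler_solution_gas_density:
  assumes "K > 0" "\<gamma> \<ge> 1" "\<alpha> \<ge> 0"
  shows "euler_solution K \<gamma> T (gas_density K \<gamma> lam \<alpha> a b) (velocity \<xi> a a' b b')"
proof -
  \<comment> \<open>For \<open>\<gamma> > 1\<close> and \<open>lam \<noteq> 0\<close> the base
    vanishes exactly on this level of \<open>s\<close>. Exponential and constant profiles have no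
    exceptional points.\<close>
  define N where "N = (if \<gamma> = 1 \<or> lam = 0 then {}
    else {p \<in> slab T. similarity_var a b p = \<alpha> / (lam * (\<gamma> - 1) / (2 * K * \<gamma>))})"
  have "negligible N"
    by (simp add: N_def negligible_similarity_level)
  moreover have "euler_equations_at K \<gamma> T (gas_density K \<gamma> lam \<alpha> a b) (velocity \<xi> a a' b b') p"
    if p: "p \<in> slab T - N" for p
  proof -
    have "\<gamma> = 1 \<or> lam = 0 \<or> - (lam * (\<gamma> - 1) / (2 * K * \<gamma>)) * similarity_var a b p + \<alpha> \<noteq> 0"
      using p assms by (auto simp: N_def field_simps split: if_splits)
    from profile_pressure_ode[OF assms this] show ?thesis
      unfolding gas_density_eq
      using euler_equations_at_similarity_flow p profile_nonneg[OF assms(3)] by blast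
  qed
  moreover have "gas_density K \<gamma> lam \<alpha> a b p \<ge> 0" if "p \<in> slab T" for p
    using that profile_nonneg[OF assms(3)] a_pos[of "fst p"] b_pos[of "fst p"]
    by (auto simp: gas_density_eq slab_def)
  ultimately show ?thesis
    unfolding euler_solution_def
    using continuous_on_gas_density[OF assms(2,1)] C1_on_imp_continuous_on[OF C1_on_velocity] by blast
qed

end

text \<open>The powers combine by \<open>a powr (1 - 2 * \<gamma>) * b powr (1 - \<gamma>) = a * b *
  (a^2 * b) powr (- \<gamma>)\<close> and its analogue for \<open>b\<close>.\<close>

lemma emden_solution_imp_emden_flow:
  assumes "T > 0" and sol: "emden_solution \<gamma> \<xi> lam a0 a1 b0 b1 T a a' b b'"
  shows "emden_flow \<gamma> \<xi> lam T a a' b b'"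
proof
  fix t assume "t \<in> time_interval T"
  then have t: "0 < a t" "0 < b t"
    "(a has_real_derivative a' t) (at t within time_interval T)"
    "(b has_real_derivative b' t) (at t within time_interval T)"
    "(a' has_real_derivative (\<xi>^2 / a t ^ 3 + lam / (a t powr (2 * \<gamma> - 1) * b t powr (\<gamma> - 1))))
      (at t within time_interval T)"
    "(b' has_real_derivative lam / (a t powr (2 * \<gamma> - 2) * b t powr \<gamma>)) (at t within time_interval T)"
    using sol by (auto simp: emden_solution_def)
  have P: "((a t)\<^sup>2 * b t) powr (- \<gamma>) = 1 / (a t powr (2 * \<gamma>) * b t powr \<gamma>)"
    using t(1,2) by (simp add: powr_mult powr_minus powr_powr divide_inverse flip: powr_numeral)
  show "0 < a t" "0 < b t" "(a has_real_derivative a' t) (at t within time_interval T)"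
    "(b has_real_derivative b' t) (at t within time_interval T)"
    by (fact t)+
  have "lam / (a t powr (2 * \<gamma> - 1) * b t powr (\<gamma> - 1)) = lam * a t * b t * ((a t)\<^sup>2 * b t) powr (- \<gamma>)"
    using t(1,2) by (simp add: P powr_diff)
  then show "(a' has_real_derivative \<xi>^2 / a t ^ 3 + lam * a t * b t * ((a t)\<^sup>2 * b t) powr (- \<gamma>))
      (at t within time_interval T)"
    using t(5) by simp
  have "lam / (a t powr (2 * \<gamma> - 2) * b t powr \<gamma>) = lam * (a t)\<^sup>2 * ((a t)\<^sup>2 * b t) powr (- \<gamma>)"
    using t(1,2) by (simp add: P powr_diff)
  then show "(b' has_real_derivative lam * (a t)\<^sup>2 * ((a t)\<^sup>2 * b t) powr (- \<gamma>)) (at t within time_interval T)"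
    using t(6) by simp
qed (fact assms(1))

text \<open>The density is exempt from the C1 claim when \<open>\<alpha> = 0\<close>,
  \<open>lam < 0\<close> and \<open>\<gamma> \<ge> 3\<close>: at each time it is then a positive
  multiple of the norm of \<open>w\<close> to the power \<open>2 / (\<gamma> - 1)\<close>, which is
  at most 1, and so it is not differentiable at the origin of space.\<close>

theorem theorem1:
  fixes K \<gamma> \<xi> lam \<alpha> a0 a1 b0 b1 :: real and T :: ereal
    and a a' b b' :: "real \<Rightarrow> real"
  assumes "K > 0" and "\<gamma> \<ge> 1" and "\<xi> \<noteq> 0" and "\<alpha> \<ge> 0" and "a0 > 0" and "b0 > 0"
    and "T > 0"
    and "emden_solution \<gamma> \<xi> lam a0 a1 b0 b1 T a a' b b'"
  shows "euler_solution K \<gamma> T (gas_density K \<gamma> lam \<alpha> a b) (velocity \<xi> a a' b b') \<and>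
    (\<gamma> = 1 \<or> (\<gamma> > 1 \<and> lam \<le> 0) \<or> (\<gamma> > 1 \<and> lam > 0 \<and> \<gamma> < 2) \<longrightarrow>
       C1_on (slab T) (velocity \<xi> a a' b b') \<and>
       (\<not> (\<alpha> = 0 \<and> lam < 0 \<and> \<gamma> \<ge> 3) \<longrightarrow> C1_on (slab T) (gas_density K \<gamma> lam \<alpha> a b)))"
proof -
  interpret emden_flow \<gamma> \<xi> lam T a a' b b'
    using emden_solution_imp_emden_flow assms(7,8) .
  show ?thesis
    using euler_solution_gas_density[OF assms(1,2,4)] C1_on_velocity
      C1_on_gas_density[OF C1_on_profile_inner[OF assms(2,1,4)]] by blast
qed

end
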